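(* Let $\lambda>-1$ and $t\ge0$ be fixed. Then the recurrence coefficients $\alpha_n$, $\beta_n$ of the monic orthogonal polynomials with respect to the weight $w(x;t)=x^{\lambda}e^{-x^3-t/x}$ on $(0,\infty)$ satisfy, as $n\to\infty$, $$\alpha_n\sim\sqrt[3]{\frac{4n}{15}},\qquad\qquad \beta_n\sim\sqrt[3]{\frac{n^2}{900}},$$ where $c_n\sim d_n$ means $\lim_{n\to\infty}c_n/d_n=1$.
   Context: For $\lambda>-1$, $t\ge0$ let $w(x;t)=x^{\lambda}e^{-x^3-t/x}$, $x\in(0,\infty)$. Let $P_n(x;t)$, $n=0,1,2,\dots$, be the monic polynomials of degree $n$ with $\int_0^\infty P_m(x;t)P_n(x;t)w(x;t)\,dx=h_n(t)\delta_{mn}$, $h_n(t)>0$. The recurrence coefficients $\alpha_n$ ($n\ge0$) and $\beta_n$ ($n\ge 1$) are defined by $xP_n(x;t)=P_{n+1}(x;t)+\alpha_n(t)P_n(x;t)+\beta_n(t)P_{n-1}(x;t)$, with $P_0=1$ and $\beta_0P_{-1}=0$; equivalently $\alpha_n=\frac1{h_n}\int_0^\infty xP_n^2w\,dx$ and $\beta_n=h_n/h_{n-1}$. *)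

theory Defs
  imports
    "HOL-Analysis.Analysis"
    "HOL-Computational_Algebra.Polynomial"
begin

definition cubic_weight :: "real \<Rightarrow> real \<Rightarrow> real \<Rightarrow> real" where
  "cubic_weight l t x = x powr l * exp (- (x ^ 3) - t / x)"

(* Only the values of w on (0, oo) matter.  The Bochner integral is 0 for a
   non-integrable function, but for the weight above with l > -1 and t >= 0 all
   these integrals converge. *)
definition monic_orthogonal_polys ::
  "(real \<Rightarrow> real) \<Rightarrow> (nat \<Rightarrow> real poly) \<Rightarrow> (nat \<Rightarrow> real) \<Rightarrow> bool" where
  "monic_orthogonal_polys w P h \<longleftrightarrow>
     (\<forall>n. degree (P n) = n \<and> lead_coeff (P n) = 1) \<and>
     (\<forall>m n. (LINT x:{0<..}|lborel. poly (P m) x * poly (P n) x * w x)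
              = (if m = n then h n else 0)) \<and>
     (\<forall>n. h n > 0)"

(* The convention \<beta>_0 P_{-1} = 0 is the n = 0 case; \<beta> 0 is left unconstrained. *)
definition recurrence_coeffs ::
  "(nat \<Rightarrow> real poly) \<Rightarrow> (nat \<Rightarrow> real) \<Rightarrow> (nat \<Rightarrow> real) \<Rightarrow> bool" where
  "recurrence_coeffs P \<alpha> \<beta> \<longleftrightarrow>
     (\<forall>n. [:0, 1:] * P n =
            P (Suc n) + smult (\<alpha> n) (P n)
              + (if n = 0 then 0 else smult (\<beta> n) (P (n - 1))))"

end

theory Submission
  imports Defs "HOL-Real_Asymp.Real_Asymp"
begin

text \<open>
  Write \<lambda> for the parameter \<open>l\<close>. The proof follows Freud's idea for the weight exp(-x^6) on the line: the substitution
  x \<mapsto> x^2 turns the weight on the half-line into the even weight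
  |x|^{2\<lambda>+1} exp(-x^6 - t/x^2), whose recurrence has a single sequence of coefficients
  \<gamma>_m, with \<alpha>_n = \<gamma>_{2n} + \<gamma>_{2n+1} and
  \<beta>_n = \<gamma>_{2n-1} \<gamma>_{2n}. It is enough to show
  \<gamma>_m \<sim> (m/60)^{1/3}.

  Integration by parts gives a string equation
  6 F(\<gamma>_{m-2},\<dots>,\<gamma>_{m+2}) = m + O(1) + R_m, where F is a cubic form with
  nonnegative coefficients (\<open>freud_form\<close>) and R_m comes from the factor
  exp(-t/x). Dividing by m and passing to
  limits along subsequences that realise the upper limit A and the lower limit a of
  \<gamma>_m / m^{1/3} yields
  A^3 + 4aA^2 + 5a^2A \<le> 1/6 \<le> a^3 + 4a^2A + 5aA^2. The difference of the outer terms is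
  (A-a)(A^2+a^2), so A = a and 10 a^3 = 1/6 (\<open>freud_form_limit\<close>).

  What has to be added to Freud's argument is R_m = o(m). Write \<langle>f \<rangle> for the
  mean of f against P_n^2 w / h_n. Integrating (P_n^2 w)' shows
  t\<langle>x^{-2}\<rangle> + \<lambda>\<langle>x^{-1}\<rangle> = 3\<langle>x^2\<rangle>, and integrating
  (x P_n^2 w)' shows 3\<langle>x^3\<rangle> = 2n + 1 + \<lambda> + t\<langle>x^{-1}\<rangle>. Together
  they give \<langle>x^3\<rangle> = O(n), hence \<gamma>_m = O(m^{1/3}) and
  t\<langle>x^{-1}\<rangle> = O(n^{2/3}). The polynomials Q_n orthogonal with respect to
  x w satisfy a similar bound, and the Cauchy-Schwarz inequality then gives
  R_m = O(m^{5/6}) (\<open>singular_term_bound\<close>).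
\<close>

section \<open>Integrals of polynomials against the weight\<close>

lemma exp_minus_le_powr:
  fixes y a :: real
  assumes "y > 0" "a > 0"
  shows "exp (- y) \<le> (a / y) powr a"
proof -
  have "y / a \<le> exp (y / a)" using exp_ge_add_one_self[of "y / a"] by linarith
  then have "(y / a) powr a \<le> exp (y / a) powr a"
    using assms by (intro powr_mono2) auto
  also have "\<dots> = exp y" using assms by (simp add: powr_def)
  finally have "exp (- y) \<le> 1 / (y / a) powr a"
    using assms by (simp add: exp_minus field_simps)
  also have "\<dots> = (a / y) powr a" using assms by (simp add: powr_divide)
  finally show ?thesis .
qed

text \<open>
  Every estimate on the weight is reduced to the Gamma density. For t > 0 the factor
  exp(-t/x) vanishes at 0 faster than any power of x, so the exponent can be raised above any
  prescribed threshold r; this is why negative shifts of \<lambda> are harmless when t > 0.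
\<close>
lemma cubic_weight_le_gamma_weight:
  fixes s t r :: real
  assumes "t \<ge> 0" and "s > r \<or> t > 0"
  obtains C s' where "s' > r" "C \<ge> 0"
    "\<And>x. x > 0 \<Longrightarrow> cubic_weight s t x \<le> C * (x powr s' * exp (- x))"
proof -
  have cube: "exp (- (x ^ 3)) \<le> exp 1 * exp (- x)" if "x > 0" for x :: real
  proof -
    have "x \<le> x ^ 3 + 1"
    proof (cases "x \<le> 1")
      case False
      then have "x ^ 1 \<le> x ^ 3" by (intro power_increasing) auto
      then show ?thesis by simp
    qed (use that in \<open>simp add: add_increasing\<close>)
    then show ?thesis by (simp flip: exp_add)
  qed
  show ?thesis
  proof (cases "s > r")
    case True
    show ?thesis
    proof (rule that[OF True])
      fix x :: real assume x: "x > 0"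
      have "exp (- (x ^ 3) - t / x) \<le> exp (- (x ^ 3))" using assms x by simp
      also note cube[OF x]
      finally show "cubic_weight s t x \<le> exp 1 * (x powr s * exp (- x))"
        using mult_left_mono[of "exp (- (x ^ 3) - t / x)" "exp 1 * exp (- x)" "x powr s"]
        by (simp add: cubic_weight_def mult_ac)
    qed simp
  next
    case False
    with assms have t: "t > 0" by simp
    define a where "a = r - s + 1"
    have a: "a > 0" using False by (simp add: a_def)
    show ?thesis
    proof (rule that)
      show "s + a > r" by (simp add: a_def)
      show "(a / t) powr a * exp 1 \<ge> 0" by simp
      fix x :: real assume x: "x > 0"
      have "exp (- (x ^ 3) - t / x) = exp (- (t / x)) * exp (- (x ^ 3))"
        by (simp flip: exp_add)
      also have "\<dots> \<le> (a / (t / x)) powr a * (exp 1 * exp (- x))"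
        using x t a by (intro mult_mono exp_minus_le_powr cube) auto
      also have "(a / (t / x)) powr a = (a / t) powr a * x powr a"
        using x t a by (simp flip: powr_mult)
      finally have "x powr s * exp (- (x ^ 3) - t / x)
          \<le> x powr s * ((a / t) powr a * x powr a * (exp 1 * exp (- x)))"
        by (intro mult_left_mono) auto
      then show "cubic_weight s t x \<le> (a / t) powr a * exp 1 * (x powr (s + a) * exp (- x))"
        by (simp add: cubic_weight_def powr_add mult_ac)
    qed
  qed
qed

lemma gamma_weight_integrable:
  fixes s :: real
  assumes "s > -1"
  shows "set_integrable lborel {0<..} (\<lambda>x. x powr s * exp (- x))"
proof -
  have "(\<lambda>t. complex_of_real t powr (of_real (s + 1) - 1) / of_real (exp t)) absolutely_integrable_on {0<..}"
    using assms by (intro absolutely_integrable_Gamma_integral') simp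
  then have "set_integrable lebesgue {0<..} (\<lambda>x. norm (complex_of_real x powr (of_real (s + 1) - 1) / of_real (exp x)))"
    by (rule set_integrable_norm)
  also have "?this \<longleftrightarrow> set_integrable lebesgue {0<..} (\<lambda>x. x powr s * exp (- x))"
    by (intro set_integrable_cong) (auto simp: norm_divide norm_powr_real_powr exp_minus field_simps)
  finally show ?thesis
    unfolding set_integrable_def by (subst (asm) integrable_completion) auto
qed

lemma cubic_weight_measurable [measurable]: "cubic_weight s t \<in> borel_measurable borel"
  unfolding cubic_weight_def by measurable

lemma cubic_weight_nonneg: "cubic_weight s t x \<ge> 0"
  by (simp add: cubic_weight_def)

lemma cubic_weight_pos: "x > 0 \<Longrightarrow> cubic_weight s t x > 0"
  by (simp add: cubic_weight_def)

lemma cubic_weight_shift: "x > 0 \<Longrightarrow> x * cubic_weight s t x = cubic_weight (s + 1) t x"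
  by (simp add: cubic_weight_def powr_add)

lemma cubic_weight_integrable:
  assumes "t \<ge> 0" "s > -1 \<or> t > 0"
  shows "set_integrable lborel {0<..} (cubic_weight s t)"
proof -
  obtain C s' where C: "s' > -1" "C \<ge> 0"
      "\<And>x. x > 0 \<Longrightarrow> cubic_weight s t x \<le> C * (x powr s' * exp (- x))"
    by (rule cubic_weight_le_gamma_weight[OF assms]) (rule that)
  show ?thesis
  proof (rule set_integrable_bound)
    show "set_integrable lborel {0<..} (\<lambda>x. C * (x powr s' * exp (- x)))"
      using gamma_weight_integrable[OF C(1)] by (rule set_integrable_mult_right)
    show "set_borel_measurable lborel {0<..} (cubic_weight s t)"
      unfolding set_borel_measurable_def by measurable
    show "AE x in lborel. x \<in> {0<..} \<longrightarrow> norm (cubic_weight s t x) \<le> norm (C * (x powr s' * exp (- x)))"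
      using C by (auto simp: cubic_weight_nonneg)
  qed
qed

lemma poly_cubic_weight_pCons:
  "x > 0 \<Longrightarrow> poly (pCons a p) x * cubic_weight s t x
     = a * cubic_weight s t x + poly p x * cubic_weight (s + 1) t x"
  by (simp only: poly_pCons cubic_weight_shift[symmetric]) (simp add: algebra_simps)

text \<open>
  The induction on the polynomial needs an arbitrary exponent s, because the step trades a
  factor x for s + 1.
\<close>
lemma poly_cubic_weight_integrable:
  assumes "t \<ge> 0" "s > -1 \<or> t > 0"
  shows "set_integrable lborel {0<..} (\<lambda>x. poly p x * cubic_weight s t x)"
  using assms
proof (induction p arbitrary: s)
  case 0
  then show ?case by (simp add: set_integrable_def)
next
  case (pCons a p)
  have "set_integrable lborel {0<..} (\<lambda>x. a * cubic_weight s t x + poly p x * cubic_weight (s + 1) t x)"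
    using pCons by (intro set_integral_add set_integrable_mult_right cubic_weight_integrable pCons.IH) auto
  then show ?case
    by (subst set_integrable_cong[OF refl refl poly_cubic_weight_pCons]) auto
qed

lemma poly_cubic_weight_at_top:
  assumes "t \<ge> 0"
  shows "((\<lambda>x. poly p x * cubic_weight s t x) \<longlongrightarrow> 0) at_top"
proof (induction p arbitrary: s)
  case 0
  then show ?case by simp
next
  case (pCons a p)
  have "((\<lambda>x. cubic_weight s t x) \<longlongrightarrow> 0) at_top"
  proof -
    obtain C s' where C: "s' > s - 1" "C \<ge> 0"
        "\<And>x. x > 0 \<Longrightarrow> cubic_weight s t x \<le> C * (x powr s' * exp (- x))"
      by (rule cubic_weight_le_gamma_weight[OF assms, of "s - 1" s]) (simp, rule that)
    have "((\<lambda>x. x powr s' * exp (- x)) \<longlongrightarrow> 0) at_top" by real_asymp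
    then have "((\<lambda>x. C * (x powr s' * exp (- x))) \<longlongrightarrow> 0) at_top" by (rule tendsto_mult_right_zero)
    then show ?thesis
      by (rule tendsto_0_le[where K=1])
         (use C in \<open>auto intro!: eventually_mono[OF eventually_gt_at_top[of 0]] simp: cubic_weight_nonneg\<close>)
  qed
  then have "((\<lambda>x. a * cubic_weight s t x + poly p x * cubic_weight (s + 1) t x) \<longlongrightarrow> a * 0 + 0) at_top"
    by (intro tendsto_intros pCons.IH)
  then show ?case
    by (subst tendsto_cong[OF eventually_mono[OF eventually_gt_at_top[of 0] poly_cubic_weight_pCons]]) auto
qed

lemma poly_cubic_weight_at_right_0:
  assumes "t \<ge> 0" "s > 0 \<or> t > 0"
  shows "((\<lambda>x. poly p x * cubic_weight s t x) \<longlongrightarrow> 0) (at_right 0)"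
proof -
  obtain C s' where C: "s' > 0" "C \<ge> 0"
      "\<And>x. x > 0 \<Longrightarrow> cubic_weight s t x \<le> C * (x powr s' * exp (- x))"
    by (rule cubic_weight_le_gamma_weight[OF assms]) (rule that)
  have "((\<lambda>x. x powr s') \<longlongrightarrow> 0 powr s') (at_right 0)"
    using C(1) by (intro tendsto_powr2 tendsto_intros eventually_at_right_less) 
      (auto intro: eventually_mono[OF eventually_at_right_less])
  then have "((\<lambda>x. C * (x powr s' * exp (- x))) \<longlongrightarrow> C * (0 * exp (- 0))) (at_right 0)"
    using C(1) by (intro tendsto_intros) auto
  then have "((\<lambda>x. C * (x powr s' * exp (- x))) \<longlongrightarrow> 0) (at_right 0)" by simp
  then have "(cubic_weight s t \<longlongrightarrow> 0) (at_right 0)"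
    by (rule tendsto_0_le[where K=1])
       (use C in \<open>auto intro!: eventually_mono[OF eventually_at_right_less] simp: cubic_weight_nonneg\<close>)
  moreover have "(poly p \<longlongrightarrow> poly p 0) (at_right 0)"
    by (intro tendsto_intros)
  ultimately show ?thesis using tendsto_mult by fastforce
qed

text \<open>
  All later arguments use only the algebra of these functionals: a factor x in the polynomial
  raises the exponent by one, squares of polynomials have nonnegative integrals, and one
  integration by parts links the exponents.
\<close>
definition wint :: "real \<Rightarrow> real \<Rightarrow> real poly \<Rightarrow> real" where
  "wint t s p = (LINT x:{0<..}|lborel. poly p x * cubic_weight s t x)"

lemma wint_shift: "wint t s (pCons 0 p) = wint t (s + 1) p"
  unfolding wint_def
  by (intro set_lebesgue_integral_cong) (auto simp: mult_ac simp flip: cubic_weight_shift)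

lemma wint_smult: "wint t s (smult c p) = c * wint t s p"
  unfolding wint_def by (simp add: mult.assoc)

lemma wint_0 [simp]: "wint t s 0 = 0"
  unfolding wint_def set_lebesgue_integral_def by simp

lemma wint_add:
  assumes "t \<ge> 0" "s > -1 \<or> t > 0"
  shows "wint t s (p + q) = wint t s p + wint t s q"
  unfolding wint_def
  using poly_cubic_weight_integrable[OF assms]
  by (simp add: distrib_right)

lemma wint_square_nonneg: "wint t s (p * p) \<ge> 0"
  unfolding wint_def set_lebesgue_integral_def
  by (intro integral_nonneg_AE AE_I2) (auto simp: indicator_def cubic_weight_nonneg)

lemma wint_square_pos:
  assumes "t \<ge> 0" "s > -1 \<or> t > 0" "p \<noteq> 0"
  shows "wint t s (p * p) > 0"
proof -
  let ?f = "\<lambda>x. indicator {0<..} x *\<^sub>R (poly (p * p) x * cubic_weight s t x)"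
  have int: "integrable lborel ?f"
    using poly_cubic_weight_integrable[OF assms(1,2)] unfolding set_integrable_def .
  have nn: "AE x in lborel. 0 \<le> ?f x"
    by (intro AE_I2) (auto simp: indicator_def cubic_weight_nonneg)
  have "wint t s (p * p) \<noteq> 0"
  proof
    assume "wint t s (p * p) = 0"
    then have "AE x in lborel. ?f x = 0"
      using integral_nonneg_eq_0_iff_AE[OF int nn] unfolding wint_def set_lebesgue_integral_def by simp
    then have "AE x in lborel. x \<notin> {0<..} - {x. poly p x = 0}"
    proof eventually_elim
      case (elim x)
      then show ?case using cubic_weight_pos[of x s t] by auto
    qed
    moreover have "AE x in lborel. x \<notin> {x. poly p x = 0}"
      using poly_roots_finite[OF assms(3)]
      by (intro AE_not_in) (simp add: finite_imp_null_set_lborel)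
    ultimately have "AE x in lborel. x \<notin> {0<..<1::real}"
      by eventually_elim auto
    then have "{0<..<1::real} \<in> null_sets lborel" by (simp add: AE_iff_null_sets)
    then show False by (simp add: null_sets_def)
  qed
  with wint_square_nonneg[of t s p] show ?thesis by linarith
qed

text \<open>
  The integral of the derivative of x p(x) w_s(x) vanishes, where
  w_s(x) = x^s e^{-x^3-t/x}. The integral with exponent s-1 may diverge when t = 0, but it
  is then multiplied by 0. The boundary term at 0 vanishes because s + 1 > 0 or t > 0.
\<close>
lemma wint_parts:
  assumes t: "t \<ge> 0" and s: "s > -1 \<or> t > 0"
  shows "3 * wint t (s + 3) p = (s + 1) * wint t s p + wint t (s + 1) (pderiv p) + t * wint t (s - 1) p"
proof -
  define F where "F = (\<lambda>x. poly p x * cubic_weight (s + 1) t x)"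
  define f where "f = (\<lambda>x. (s + 1) * (poly p x * cubic_weight s t x)
     + poly (pderiv p) x * cubic_weight (s + 1) t x
     + t * (poly p x * cubic_weight (s - 1) t x) - 3 * (poly p x * cubic_weight (s + 3) t x))"
  have intt: "set_integrable lborel {0<..} (\<lambda>x. t * (poly p x * cubic_weight (s - 1) t x))"
  proof (cases "t = 0")
    case False
    then show ?thesis using t by (intro set_integrable_mult_right poly_cubic_weight_integrable) auto
  qed (simp add: set_integrable_def)
  have s': "s + 1 > -1 \<or> t > 0" "s + 3 > -1 \<or> t > 0" using s by auto
  note ints = poly_cubic_weight_integrable[OF t s, of p]
     poly_cubic_weight_integrable[OF t s'(1), of "pderiv p"]
     poly_cubic_weight_integrable[OF t s'(2), of p] intt
  have f_int: "set_integrable lborel {0<..} f"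
    unfolding f_def by (intro set_integral_add set_integral_diff set_integrable_mult_right ints)
  have ein: "einterval 0 \<infinity> = {0::real<..}" by (auto simp: einterval_def zero_ereal_def)
  have deriv: "(F has_vector_derivative f x) (at x)" if "x > 0" for x
  proof -
    have "(F has_real_derivative
        (poly (pderiv p) x * (x powr (s + 1) * exp (- (x ^ 3) - t / x))
         + ((s + 1) * x powr s * exp (- (x ^ 3) - t / x)
            + exp (- (x ^ 3) - t / x) * (- (3 * x ^ 2) + t / x ^ 2) * x powr (s + 1)) * poly p x)) (at x)"
      unfolding F_def cubic_weight_def using that
      by (auto intro!: derivative_eq_intros simp: power2_eq_square)
    also have "(poly (pderiv p) x * (x powr (s + 1) * exp (- (x ^ 3) - t / x))
         + ((s + 1) * x powr s * exp (- (x ^ 3) - t / x)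
            + exp (- (x ^ 3) - t / x) * (- (3 * x ^ 2) + t / x ^ 2) * x powr (s + 1)) * poly p x) = f x"
      using that unfolding f_def cubic_weight_def
      by (simp add: powr_add powr_diff powr_numeral field_simps power2_eq_square power3_eq_cube)
    finally show ?thesis by (simp add: has_real_derivative_iff_has_vector_derivative)
  qed
  have "(LBINT x=0..\<infinity>. f x) = 0 - 0"
  proof (rule interval_integral_FTC_integrable)
    show "(F has_vector_derivative f x) (at x)" if "0 < ereal x" for x using deriv that by simp
    show "isCont f x" if "0 < ereal x" for x
      using that unfolding f_def cubic_weight_def by (intro continuous_intros) auto
    show "set_integrable lborel (einterval 0 \<infinity>) f" unfolding ein by (rule f_int)
    show "((F \<circ> real_of_ereal) \<longlongrightarrow> 0) (at_right 0)"
      using poly_cubic_weight_at_right_0[OF t, of "s + 1" p] s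
      unfolding zero_ereal_def ereal_tendsto_simps F_def by auto
    show "((F \<circ> real_of_ereal) \<longlongrightarrow> 0) (at_left \<infinity>)"
      using poly_cubic_weight_at_top[OF t, of p "s + 1"]
      unfolding ereal_tendsto_simps F_def by simp
  qed auto
  then have "(LINT x:{0<..}|lborel. f x) = 0"
    by (simp add: interval_lebesgue_integral_def ein)
  moreover have "(LINT x:{0<..}|lborel. f x) = (s + 1) * wint t s p + wint t (s + 1) (pderiv p)
      + t * wint t (s - 1) p - 3 * wint t (s + 3) p"
    unfolding f_def wint_def
    by (subst set_integral_diff(2) set_integral_add(2),
        intro set_integral_add set_integral_diff set_integrable_mult_right ints,
        intro set_integral_add set_integral_diff set_integrable_mult_right ints)+ simp
  ultimately show ?thesis by simp
qed

section \<open>The limit of a positive solution of the string equation\<close>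

text \<open>
  For the even weight exp(-x^6) the integral of x^5 q_m q_{m-1} against the weight, with q_m the monic
  orthogonal polynomials, is this form in \<gamma>_{m-2},\<dots>,\<gamma>_{m+2} times the
  square norm of q_{m-1}: it sums over the ten lattice
  paths from m to m-1 with five unit steps, each weighted by the \<gamma>'s of its down-steps.
\<close>
definition freud_form :: "real \<Rightarrow> real \<Rightarrow> real \<Rightarrow> real \<Rightarrow> real \<Rightarrow> real" where
  "freud_form y0 y1 y2 y3 y4 =
     y2 * (y0 * y1 + y1\<^sup>2 + 2 * y1 * y2 + y1 * y3 + y2\<^sup>2 + 2 * y2 * y3 + y3\<^sup>2 + y3 * y4)"

lemma freud_form_lower:
  assumes "0 \<le> a" "a \<le> A" "a \<le> y0" "a \<le> y1" "a \<le> y3" "a \<le> y4"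
  shows "A * (5 * a\<^sup>2 + 4 * a * A + A\<^sup>2) \<le> freud_form y0 y1 A y3 y4"
proof -
  have "a * a \<le> y0 * y1" "a * a \<le> y1 * y1" "a * A \<le> y1 * A" "a * a \<le> y1 * y3"
       "A * a \<le> A * y3" "a * a \<le> y3 * y3" "a * a \<le> y3 * y4"
    using assms by (auto intro!: mult_mono)
  then have "5 * a\<^sup>2 + 4 * a * A + A\<^sup>2 \<le> y0 * y1 + y1\<^sup>2 + 2 * y1 * A + y1 * y3 + A\<^sup>2 + 2 * A * y3 + y3\<^sup>2 + y3 * y4"
    by (simp add: power2_eq_square algebra_simps)
  then show ?thesis using assms unfolding freud_form_def by (intro mult_left_mono) auto
qed

lemma freud_form_upper:
  assumes "0 \<le> a" "0 \<le> y0" "0 \<le> y1" "0 \<le> y3" "0 \<le> y4" "y0 \<le> A" "y1 \<le> A" "y3 \<le> A" "y4 \<le> A"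
  shows "freud_form y0 y1 a y3 y4 \<le> a * (5 * A\<^sup>2 + 4 * a * A + a\<^sup>2)"
proof -
  have "y0 * y1 \<le> A * A" "y1 * y1 \<le> A * A" "y1 * a \<le> A * a" "y1 * y3 \<le> A * A"
       "a * y3 \<le> a * A" "y3 * y3 \<le> A * A" "y3 * y4 \<le> A * A"
    using assms by (auto intro!: mult_mono)
  then have "y0 * y1 + y1\<^sup>2 + 2 * y1 * a + y1 * y3 + a\<^sup>2 + 2 * a * y3 + y3\<^sup>2 + y3 * y4 \<le> 5 * A\<^sup>2 + 4 * a * A + a\<^sup>2"
    by (simp add: power2_eq_square algebra_simps)
  then show ?thesis using assms unfolding freud_form_def by (intro mult_left_mono) auto
qed

text \<open>
  The difference of the two bounds on c factors as (A - a)(A^2 + a^2).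
\<close>
lemma freud_squeeze:
  fixes a A c :: real
  assumes "0 \<le> a" "a \<le> A"
    and "A * (5 * a\<^sup>2 + 4 * a * A + A\<^sup>2) \<le> c" "c \<le> a * (5 * A\<^sup>2 + 4 * a * A + a\<^sup>2)"
  shows "A = a"
proof (rule ccontr)
  assume "A \<noteq> a"
  with assms have "A > a" by simp
  with assms(1) have "(A - a) * (A\<^sup>2 + a\<^sup>2) > 0"
    by (intro mult_pos_pos add_pos_nonneg) auto
  also have "(A - a) * (A\<^sup>2 + a\<^sup>2)
      = A * (5 * a\<^sup>2 + 4 * a * A + A\<^sup>2) - a * (5 * A\<^sup>2 + 4 * a * A + a\<^sup>2)"
    by (simp add: power2_eq_square algebra_simps)
  finally show False using assms(3,4) by linarith
qed

lemma freud_form_homogeneous: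
  "freud_form (y0 / d) (y1 / d) (y2 / d) (y3 / d) (y4 / d) = freud_form y0 y1 y2 y3 y4 / d ^ 3"
  unfolding freud_form_def
  by (cases "d = 0") (simp_all add: field_simps power2_eq_square power3_eq_cube)

text \<open>
  Along a subsequence that realises the upper limit A, compactness makes the four neighbouring
  terms converge as well, to limits that are at least the lower limit a. The form is
  increasing in these neighbours, so the equation in the limit bounds an expression in a and A;
  exchanging the roles of a and A gives the opposite inequality.
\<close>
lemma freud_form_limit:
  fixes x :: "nat \<Rightarrow> real"
  assumes nonneg: "\<And>m. 0 \<le> x m"
    and bound: "\<And>m. x m / root 3 m \<le> K"
    and lim: "(\<lambda>m. freud_form (x m) (x (m+1)) (x (m+2)) (x (m+3)) (x (m+4)) / real m) \<longlonglongrightarrow> c"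
  shows "(\<lambda>m. x m / root 3 m) \<longlonglongrightarrow> root 3 (c / 10)"
proof -
  define X where "X = (\<lambda>m. x m / root 3 (real m))"
  have X0: "0 \<le> X m" for m using nonneg[of m] by (simp add: X_def)
  have XK: "X m \<le> K" for m using bound by (simp add: X_def)
  have bddX: "norm (X m) \<le> K" for m using X0 XK by simp

  have ratio: "(\<lambda>m. root 3 (real (m + j)) / root 3 (real m)) \<longlonglongrightarrow> 1" for j
  proof -
    have "(\<lambda>m. root 3 ((real m + real j) / real m)) \<longlonglongrightarrow> root 3 1"
      by (intro tendsto_real_root) real_asymp
    then show ?thesis by (simp add: real_root_divide)
  qed

  have subseq: "\<exists>s y0 y1 y3 y4. strict_mono (s :: nat \<Rightarrow> nat) \<and> freud_form y0 y1 y y3 y4 = c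
      \<and> (\<lambda>n. X (s n)) \<longlonglongrightarrow> y0 \<and> (\<lambda>n. X (s n + 1)) \<longlonglongrightarrow> y1
      \<and> (\<lambda>n. X (s n + 3)) \<longlonglongrightarrow> y3 \<and> (\<lambda>n. X (s n + 4)) \<longlonglongrightarrow> y4"
    if r: "strict_mono r" and ry: "(\<lambda>n. X (r n)) \<longlonglongrightarrow> y" for r :: "nat \<Rightarrow> nat" and y
  proof -
    \<comment> \<open>The index of the form is that of its first argument, two below the central one.\<close>
    define q where "q = (\<lambda>n. r (n + 2) - 2)"
    have r2: "r (n + 2) \<ge> 2" for n
      using strict_mono_imp_increasing[OF r, of "n + 2"] by simp
    have q: "strict_mono q"
      unfolding q_def strict_mono_Suc_iff using r r2
      by (metis add_Suc diff_less_mono lessI strict_mono_Suc_iff)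
    have "q n + 2 = r (n + 2)" for n using r2[of n] by (simp add: q_def)
    then have qy: "(\<lambda>n. X (q n + 2)) \<longlonglongrightarrow> y"
      using LIMSEQ_ignore_initial_segment[OF ry, of 2] by simp
    define f where "f = (\<lambda>n. (X (q n), X (q n + 1), X (q n + 3), X (q n + 4)))"
    have "range f \<subseteq> cball 0 K \<times> cball 0 K \<times> cball 0 K \<times> cball 0 K"
      using bddX by (auto simp: f_def)
    then have "bounded (range f)"
      by (rule bounded_subset[rotated]) (intro bounded_Times bounded_cball)
    then obtain l p where p: "strict_mono p" and fl: "(f \<circ> p) \<longlonglongrightarrow> l"
      using bounded_imp_convergent_subsequence by blast
    obtain y0 y1 y3 y4 where l: "l = (y0, y1, y3, y4)" by (metis surj_pair)
    define s where "s = q \<circ> p"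
    have s: "strict_mono s" unfolding s_def using q p by (rule strict_mono_o)
    have lims: "(\<lambda>n. X (s n)) \<longlonglongrightarrow> y0" "(\<lambda>n. X (s n + 1)) \<longlonglongrightarrow> y1"
        "(\<lambda>n. X (s n + 3)) \<longlonglongrightarrow> y3" "(\<lambda>n. X (s n + 4)) \<longlonglongrightarrow> y4"
      using tendsto_fst[OF fl] tendsto_fst[OF tendsto_snd[OF fl]]
        tendsto_fst[OF tendsto_snd[OF tendsto_snd[OF fl]]] tendsto_snd[OF tendsto_snd[OF tendsto_snd[OF fl]]]
      by (simp_all add: l f_def s_def o_def)
    have sy: "(\<lambda>n. X (s n + 2)) \<longlonglongrightarrow> y"
      using LIMSEQ_subseq_LIMSEQ[OF qy p] by (simp add: s_def o_def)
    have shifted: "(\<lambda>n. x (s n + j) / root 3 (real (s n))) \<longlonglongrightarrow> z"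
      if "(\<lambda>n. X (s n + j)) \<longlonglongrightarrow> z" for j z
    proof -
      have L: "(\<lambda>n. X (s n + j) * (root 3 (real (s n + j)) / root 3 (real (s n)))) \<longlonglongrightarrow> z * 1"
        using that LIMSEQ_subseq_LIMSEQ[OF ratio s, of j] by (intro tendsto_mult) (simp_all add: o_def)
      have "eventually (\<lambda>n. s n > 0) sequentially"
        using filterlim_subseq[OF s] by (metis eventually_gt_at_top filterlim_iff)
      then have "eventually (\<lambda>n. X (s n + j) * (root 3 (real (s n + j)) / root 3 (real (s n)))
          = x (s n + j) / root 3 (real (s n))) sequentially"
        by eventually_elim (auto simp: X_def)
      from Lim_transform_eventually[OF L this] show ?thesis by simp
    qed
    have "(\<lambda>n. freud_form (x (s n) / root 3 (s n)) (x (s n + 1) / root 3 (s n)) (x (s n + 2) / root 3 (s n))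
        (x (s n + 3) / root 3 (s n)) (x (s n + 4) / root 3 (s n))) \<longlonglongrightarrow> freud_form y0 y1 y y3 y4"
      unfolding freud_form_def
      using shifted[of 0] shifted[of 1] shifted[of 2] shifted[of 3] shifted[of 4] lims sy
      by (intro tendsto_intros) auto
    moreover have "(\<lambda>n. freud_form (x (s n) / root 3 (s n)) (x (s n + 1) / root 3 (s n)) (x (s n + 2) / root 3 (s n))
        (x (s n + 3) / root 3 (s n)) (x (s n + 4) / root 3 (s n))) \<longlonglongrightarrow> c"
      unfolding freud_form_homogeneous using LIMSEQ_subseq_LIMSEQ[OF lim s]
      by (simp add: o_def)
    ultimately have "freud_form y0 y1 y y3 y4 = c" by (rule LIMSEQ_unique)
    with s lims show ?thesis by blast
  qed

  define b where "b = liminf (\<lambda>m. ereal (X m))"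
  define B where "B = limsup (\<lambda>m. ereal (X m))"
  have b0: "0 \<le> b" unfolding b_def by (intro Liminf_bounded always_eventually) (simp add: X0)
  have BK: "B \<le> ereal K" unfolding B_def by (intro Limsup_bounded always_eventually) (simp add: XK)
  have bB: "b \<le> B" unfolding b_def B_def by (intro Liminf_le_Limsup) simp
  obtain a where a: "b = ereal a" using b0 BK bB by (cases b) auto
  obtain A where A: "B = ereal A" using b0 BK bB by (cases B) auto
  have a0: "0 \<le> a" and aA: "a \<le> A" using b0 bB a A by auto
  have between: "a \<le> y \<and> y \<le> A"
    if "strict_mono r" "(\<lambda>n. X (r n)) \<longlonglongrightarrow> y" for r :: "nat \<Rightarrow> nat" and y
  proof -
    have *: "((\<lambda>m. ereal (X m)) \<circ> r) \<longlonglongrightarrow> ereal y" using that(2) by (simp add: o_def)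
    have "b \<le> liminf ((\<lambda>m. ereal (X m)) \<circ> r)"
      unfolding b_def by (rule liminf_subseq_mono[OF that(1)])
    moreover have "limsup ((\<lambda>m. ereal (X m)) \<circ> r) \<le> B"
      unfolding B_def by (rule limsup_subseq_mono[OF that(1)])
    ultimately show ?thesis
      using lim_imp_Liminf[OF _ *] lim_imp_Limsup[OF _ *] a A by auto
  qed
  have between_shift: "a \<le> y \<and> y \<le> A"
    if "strict_mono s" "(\<lambda>n. X (s n + j)) \<longlonglongrightarrow> y" for s :: "nat \<Rightarrow> nat" and y j
    using between[of "\<lambda>n. s n + j"] that by (auto simp: strict_mono_def)

  have upper: "A * (5 * a\<^sup>2 + 4 * a * A + A\<^sup>2) \<le> c"
  proof -
    obtain r where r: "strict_mono r" "((\<lambda>m. ereal (X m)) \<circ> r) \<longlonglongrightarrow> B"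
      unfolding B_def using limsup_subseq_lim by blast
    then have "(\<lambda>n. X (r n)) \<longlonglongrightarrow> A" by (simp add: A o_def)
    from subseq[OF r(1) this] obtain s y0 y1 y3 y4 where s: "strict_mono s" "freud_form y0 y1 A y3 y4 = c"
        "(\<lambda>n. X (s n)) \<longlonglongrightarrow> y0" "(\<lambda>n. X (s n + 1)) \<longlonglongrightarrow> y1"
        "(\<lambda>n. X (s n + 3)) \<longlonglongrightarrow> y3" "(\<lambda>n. X (s n + 4)) \<longlonglongrightarrow> y4"
      by blast
    show ?thesis
      unfolding s(2)[symmetric]
      by (intro freud_form_lower a0 aA)
         (use between[OF s(1,3)] between_shift[OF s(1,4)] between_shift[OF s(1,5)] between_shift[OF s(1,6)] in auto)
  qed
  have lower: "c \<le> a * (5 * A\<^sup>2 + 4 * a * A + a\<^sup>2)"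
  proof -
    obtain r where r: "strict_mono r" "((\<lambda>m. ereal (X m)) \<circ> r) \<longlonglongrightarrow> b"
      unfolding b_def using liminf_subseq_lim by blast
    then have "(\<lambda>n. X (r n)) \<longlonglongrightarrow> a" by (simp add: a o_def)
    from subseq[OF r(1) this] obtain s y0 y1 y3 y4 where s: "strict_mono s" "freud_form y0 y1 a y3 y4 = c"
        "(\<lambda>n. X (s n)) \<longlonglongrightarrow> y0" "(\<lambda>n. X (s n + 1)) \<longlonglongrightarrow> y1"
        "(\<lambda>n. X (s n + 3)) \<longlonglongrightarrow> y3" "(\<lambda>n. X (s n + 4)) \<longlonglongrightarrow> y4"
      by blast
    show ?thesis
      unfolding s(2)[symmetric]
      by (intro freud_form_upper a0)
         (use a0 between[OF s(1,3)] between_shift[OF s(1,4)] between_shift[OF s(1,5)] between_shift[OF s(1,6)] in auto)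
  qed
  have Aa: "A = a" by (rule freud_squeeze[OF a0 aA upper lower])
  then have "b = B" by (simp add: a A)
  then have "(\<lambda>m. ereal (X m)) \<longlonglongrightarrow> ereal A"
    unfolding A[symmetric] b_def B_def by (subst tendsto_iff_Liminf_eq_Limsup) auto
  then have "X \<longlonglongrightarrow> A" by simp
  moreover have "c / 10 = A ^ 3"
    using upper lower Aa by (simp add: power2_eq_square power3_eq_cube algebra_simps)
  ultimately show ?thesis
    using a0 Aa by (simp add: X_def real_root_power_cancel)
qed

section \<open>The string equations\<close>

lemma wint_cauchy_schwarz:
  assumes "t \<ge> 0" "s > -1 \<or> t > 0"
  shows "(wint t s (p * q))\<^sup>2 \<le> wint t s (p * p) * wint t s (q * q)"
proof (cases "q = 0")
  case False
  define A B D where "A = wint t s (p * p)" and "B = wint t s (p * q)" and "D = wint t s (q * q)"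
  have D: "D > 0" unfolding D_def by (rule wint_square_pos[OF assms False])
  have "(smult D p - smult B q) * (smult D p - smult B q)
      = smult (D * D) (p * p) + (smult (- 2 * D * B) (p * q) + smult (B * B) (q * q))"
    by (simp add: algebra_simps flip: smult_add_left)
  then have "0 \<le> D * D * A + (- 2 * D * B * B + B * B * D)"
    using wint_square_nonneg[of t s "smult D p - smult B q"]
    by (simp only: wint_add[OF assms] wint_smult flip: A_def B_def D_def)
  also have "\<dots> = D * (A * D - B\<^sup>2)" by (simp add: power2_eq_square algebra_simps)
  finally show ?thesis
    using D by (simp add: zero_le_mult_iff A_def B_def D_def)
qed simp

text \<open>
  This is the positivity of the integral of (c - dx)^2 p(x)^2. Every moment
  inequality for P_n below is a combination of instances of this one.
\<close>
lemma wint_linear_weight: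
  assumes "t \<ge> 0" "s > -1 \<or> t > 0"
  shows "2 * c * d * wint t (s + 1) (p * p) \<le> c\<^sup>2 * wint t s (p * p) + d\<^sup>2 * wint t (s + 2) (p * p)"
proof -
  have "([:c, - d:] * p) * ([:c, - d:] * p)
     = smult (c\<^sup>2) (p * p) + (smult (- 2 * c * d) (pCons 0 (p * p)) + smult (d\<^sup>2) (pCons 0 (pCons 0 (p * p))))"
    by (simp add: algebra_simps power2_eq_square flip: smult_add_left)
  then have "0 \<le> c\<^sup>2 * wint t s (p * p) + (- 2 * c * d * wint t (s + 1) (p * p) + d\<^sup>2 * wint t (s + 2) (p * p))"
    using wint_square_nonneg[of t s "[:c, - d:] * p"]
    by (simp only: wint_add[OF assms] wint_smult wint_shift add.assoc one_add_one)
  then show ?thesis by simp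
qed

locale cubic_orthogonal =
  fixes l t :: real and P :: "nat \<Rightarrow> real poly" and h \<alpha> \<beta> :: "nat \<Rightarrow> real"
  assumes l: "l > -1" and t: "t \<ge> 0"
    and ortho: "monic_orthogonal_polys (cubic_weight l t) P h"
    and recur: "recurrence_coeffs P \<alpha> \<beta>"
begin

abbreviation J :: "real poly \<Rightarrow> real" where "J \<equiv> wint t l"

lemma adm: "l > -1 \<or> t > 0" "l + 1 > -1 \<or> t > 0"
  using l by auto

lemmas J_add = wint_add[OF t adm(1)]

lemma degree_P: "degree (P n) = n" and h_pos: "h n > 0"
  and J_PP: "J (P m * P n) = (if m = n then h n else 0)"
  using ortho unfolding monic_orthogonal_polys_def wint_def by (auto simp: poly_mult)

lemma coeff_P: "coeff (P n) n = 1"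
  using ortho unfolding monic_orthogonal_polys_def by metis

lemma P_nonzero: "P n \<noteq> 0"
  using coeff_P[of n] by auto

text \<open>
  The integer m bounds the degree and is separated from n for the induction; the case m = n
  says that the functional picks out the leading coefficient, the case m < n is orthogonality to
  lower degrees.
\<close>
lemma J_P_span:
  "m \<le> n \<Longrightarrow> degree p \<le> m \<Longrightarrow> J (P n * p) = (if m = n then coeff p m * h n else 0)"
proof (induction m arbitrary: p)
  case 0
  have "P 0 = [:1:]"
    using degree_P[of 0] coeff_P[of 0] by (metis coeff_pCons_0 degree_eq_zeroE)
  moreover obtain c where "p = [:c:]" using 0(2) by (metis degree_eq_zeroE le_zero_eq)
  ultimately have "p = smult c (P 0)" "coeff p 0 = c" by simp_all
  then show ?case using J_PP[of n 0] by (auto simp: wint_smult)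
next
  case (Suc m)
  define r where "r = p - smult (coeff p (Suc m)) (P (Suc m))"
  have "degree r \<le> m"
  proof (rule degree_le, intro allI impI)
    fix i assume "m < i"
    then have "i = Suc m \<or> (coeff p i = 0 \<and> coeff (P (Suc m)) i = 0)"
      using Suc.prems(2) degree_P[of "Suc m"] by (auto intro!: coeff_eq_0)
    then show "coeff r i = 0" using coeff_P[of "Suc m"] by (auto simp: r_def)
  qed
  then have "J (P n * r) = 0" using Suc.IH[of r] Suc.prems by simp
  moreover have "p = r + smult (coeff p (Suc m)) (P (Suc m))" by (simp add: r_def)
  then have "J (P n * p) = J (P n * r) + coeff p (Suc m) * J (P n * P (Suc m))"
    by (metis J_add distrib_left mult_smult_right wint_smult)
  ultimately show ?case using J_PP[of n "Suc m"] by auto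
qed

lemma J_P: "degree p \<le> n \<Longrightarrow> J (P n * p) = coeff p n * h n"
  using J_P_span[of n n p] by simp

lemma recurrence_0: "pCons 0 (P 0) = P 1 + smult (\<alpha> 0) (P 0)"
  and recurrence_Suc: "pCons 0 (P (Suc n)) = P (Suc (Suc n)) + smult (\<alpha> (Suc n)) (P (Suc n)) + smult (\<beta> (Suc n)) (P n)"
  using recur unfolding recurrence_coeffs_def
  by (auto dest: spec[of _ 0] spec[of _ "Suc n"])

text \<open>
  If P_n = x R, then \<integral> x R^2 w = \<integral> P_n R w = 0, which contradicts positivity.
\<close>
lemma poly_P_0_nonzero: "poly (P n) 0 \<noteq> 0"
proof
  assume root: "poly (P n) 0 = 0"
  obtain c R where "P n = pCons c R" by (cases "P n") auto
  with root have R: "P n = pCons 0 R" by simp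
  with P_nonzero[of n] have "R \<noteq> 0" by auto
  with R degree_P[of n] have "degree R < n" by auto
  then have "J (P n * R) = 0" by (simp add: J_P coeff_eq_0)
  moreover have "J (P n * R) = wint t (l + 1) (R * R)" by (simp add: R wint_shift)
  ultimately show False using wint_square_pos[OF t adm(2) \<open>R \<noteq> 0\<close>] by simp
qed

text \<open>
  The numbers \<open>g n\<close> and \<open>e n\<close> are the coefficients \<gamma>_{2n+1} and
  \<gamma>_{2n} of the symmetrised recurrence, and \<open>Q n\<close> below is the kernel polynomial:
  the monic orthogonal polynomial for the weight x w. In the variable x^2 the orthogonal
  polynomials of the even weight are P_n(x^2) and x Q_n(x^2). The constant \<open>g n\<close> is
  chosen so that P_{n+1} + g_n P_n vanishes at 0.
\<close>
definition g :: "nat \<Rightarrow> real" where "g n = - poly (P (Suc n)) 0 / poly (P n) 0"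

definition e :: "nat \<Rightarrow> real" where "e n = (if n = 0 then 0 else \<beta> n / g (n - 1))"

definition Q :: "nat \<Rightarrow> real poly" where
  "Q n = (P (Suc n) + smult (g n) (P n)) div [:0, 1:]"

lemma pCons_Q: "pCons 0 (Q n) = P (Suc n) + smult (g n) (P n)"
proof -
  have "poly (P (Suc n) + smult (g n) (P n)) 0 = 0"
    using poly_P_0_nonzero[of n] by (simp add: g_def)
  then have "[:0, 1:] dvd P (Suc n) + smult (g n) (P n)"
    by (metis minus_zero poly_eq_0_iff_dvd)
  then have "[:0, 1:] * Q n = P (Suc n) + smult (g n) (P n)"
    unfolding Q_def by (rule dvd_mult_div_cancel)
  then show ?thesis by simp
qed

lemma coeff_Q_Suc: "coeff (Q n) i = coeff (P (Suc n)) (Suc i) + g n * coeff (P n) (Suc i)"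
  using arg_cong[OF pCons_Q[of n], of "\<lambda>p. coeff p (Suc i)"] by simp

lemma coeff_Q: "coeff (Q n) n = 1"
  using coeff_P[of "Suc n"] by (simp add: coeff_Q_Suc coeff_eq_0 degree_P)

lemma degree_Q: "degree (Q n) = n"
proof (rule antisym)
  show "degree (Q n) \<le> n"
    by (rule degree_le) (simp add: coeff_Q_Suc coeff_eq_0 degree_P)
  show "n \<le> degree (Q n)" by (rule le_degree) (simp add: coeff_Q)
qed

lemma wint_Q:
  assumes "degree p \<le> n"
  shows "wint t (l + 1) (Q n * p) = coeff p n * (g n * h n)"
proof -
  have "wint t (l + 1) (Q n * p) = J (pCons 0 (Q n) * p)" by (simp add: wint_shift)
  also have "\<dots> = J (P (Suc n) * p) + g n * J (P n * p)"
    by (simp add: pCons_Q distrib_right J_add wint_smult)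
  also have "\<dots> = coeff p n * (g n * h n)"
    using assms by (simp add: J_P coeff_eq_0)
  finally show ?thesis .
qed

lemma g_pos: "g n > 0"
proof -
  have "Q n \<noteq> 0" using coeff_Q[of n] by auto
  from wint_square_pos[OF t adm(2) this] have "g n * h n > 0"
    by (simp add: wint_Q degree_Q coeff_Q)
  then show ?thesis using h_pos[of n] by (simp add: zero_less_mult_iff)
qed

lemma J_xP_P: "J (pCons 0 (P n) * P n) = \<alpha> n * h n"
  by (cases n)
     (simp_all only: recurrence_0 recurrence_Suc distrib_right, simp_all add: J_add wint_smult J_PP)

lemma J_xP_P_Suc: "J (pCons 0 (P (Suc n)) * P n) = \<beta> (Suc n) * h n"
  by (simp only: recurrence_Suc distrib_right) (simp add: J_add wint_smult J_PP)

lemma h_Suc: "h (Suc n) = \<beta> (Suc n) * h n"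
proof -
  have "J (P (Suc n) * pCons 0 (P n)) = h (Suc n)"
    by (subst J_P) (auto simp: degree_P coeff_P P_nonzero)
  moreover have "P (Suc n) * pCons 0 (P n) = pCons 0 (P (Suc n)) * P n" by simp
  ultimately show ?thesis using J_xP_P_Suc by metis
qed

lemma \<beta>_eq: "\<beta> (Suc n) = g n * e (Suc n)"
  using g_pos[of n] by (simp add: e_def)

lemma e_nonneg: "e n \<ge> 0"
proof (cases n)
  case (Suc m)
  have "\<beta> (Suc m) * h m > 0" using h_pos[of "Suc m"] by (simp add: h_Suc)
  then have "\<beta> (Suc m) > 0" using h_pos[of m] by (simp add: zero_less_mult_iff)
  then show ?thesis using g_pos[of m] Suc by (simp add: e_def)
qed (simp add: e_def)

text \<open>
  The recurrence evaluated at 0.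
\<close>
lemma \<alpha>_eq: "\<alpha> n = g n + e n"
proof (cases n)
  case 0
  have "0 = poly (P 1) 0 + \<alpha> 0 * poly (P 0) 0"
    using arg_cong[OF recurrence_0, of "\<lambda>p. poly p 0"] by simp
  then have "\<alpha> 0 * poly (P 0) 0 = - poly (P 1) 0" by simp
  then show ?thesis using 0 poly_P_0_nonzero[of 0] by (simp add: e_def g_def field_simps)
next
  case (Suc m)
  have "0 = poly (P (Suc (Suc m))) 0 + \<alpha> (Suc m) * poly (P (Suc m)) 0 + \<beta> (Suc m) * poly (P m) 0"
    using arg_cong[OF recurrence_Suc[of m], of "\<lambda>p. poly p 0"] by simp
  then show ?thesis
    using Suc poly_P_0_nonzero[of m] poly_P_0_nonzero[of "Suc m"] by (simp add: e_def g_def field_simps)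
qed

lemma J_xP_xP: "J (pCons 0 (P (Suc n)) * pCons 0 (P (Suc n)))
    = h (Suc n) * (\<beta> (Suc (Suc n)) + (\<alpha> (Suc n))\<^sup>2 + \<beta> (Suc n))"
  unfolding recurrence_Suc
  by (simp add: distrib_right distrib_left J_add wint_smult J_PP)
     (simp add: h_Suc power2_eq_square algebra_simps)

lemma J_xP_xP_Suc: "J (pCons 0 (P n) * pCons 0 (P (Suc n))) = h (Suc n) * (\<alpha> n + \<alpha> (Suc n))"
proof (cases n)
  case 0
  show ?thesis unfolding 0 recurrence_Suc recurrence_0
    by (simp add: distrib_right distrib_left J_add wint_smult J_PP h_Suc algebra_simps)
next
  case (Suc m)
  show ?thesis unfolding Suc recurrence_Suc
    by (simp add: distrib_right distrib_left J_add wint_smult J_PP h_Suc algebra_simps)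
qed

lemma wint_cube: "wint t (l + 3) p = J (pCons 0 (pCons 0 (pCons 0 p)))"
  by (simp add: wint_shift add.assoc)

text \<open>
  Both identities write x^3 P Q as a product of xP and x \<cdot> xQ, replace xQ by the
  P's, and read off the integral from the three-term recurrence.
\<close>
lemma freud_form_even:
  "wint t (l + 3) (P (Suc n) * Q n)
     = g n * h n * freud_form (e n) (g n) (e (Suc n)) (g (Suc n)) (e (Suc (Suc n)))"
proof -
  have "pCons 0 (pCons 0 (pCons 0 (P (Suc n) * Q n))) = pCons 0 (P (Suc n)) * pCons 0 (pCons 0 (Q n))"
    by simp
  also have "pCons 0 (pCons 0 (Q n)) = pCons 0 (P (Suc n)) + smult (g n) (pCons 0 (P n))"
    by (simp add: pCons_Q)
  also have "pCons 0 (P (Suc n)) * \<dots> = pCons 0 (P (Suc n)) * pCons 0 (P (Suc n))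
      + smult (g n) (pCons 0 (P n) * pCons 0 (P (Suc n)))"
    by (simp add: distrib_left mult.commute)
  finally have "wint t (l + 3) (P (Suc n) * Q n)
     = J (pCons 0 (P (Suc n)) * pCons 0 (P (Suc n))) + g n * J (pCons 0 (P n) * pCons 0 (P (Suc n)))"
    by (simp only: wint_cube J_add wint_smult)
  also have "\<dots> = h (Suc n) * ((\<beta> (Suc (Suc n)) + (\<alpha> (Suc n))\<^sup>2 + \<beta> (Suc n)) + g n * (\<alpha> n + \<alpha> (Suc n)))"
    by (simp only: J_xP_xP J_xP_xP_Suc) (simp add: algebra_simps)
  also have "\<dots> = g n * h n * freud_form (e n) (g n) (e (Suc n)) (g (Suc n)) (e (Suc (Suc n)))"
    by (simp add: h_Suc \<beta>_eq \<alpha>_eq freud_form_def power2_eq_square algebra_simps)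
  finally show ?thesis .
qed

lemma freud_form_odd:
  "wint t (l + 3) (P (Suc n) * Q (Suc n))
     = h (Suc n) * freud_form (g n) (e (Suc n)) (g (Suc n)) (e (Suc (Suc n))) (g (Suc (Suc n)))"
proof -
  have "pCons 0 (pCons 0 (pCons 0 (P (Suc n) * Q (Suc n)))) = pCons 0 (P (Suc n)) * pCons 0 (pCons 0 (Q (Suc n)))"
    by simp
  also have "pCons 0 (pCons 0 (Q (Suc n))) = pCons 0 (P (Suc (Suc n))) + smult (g (Suc n)) (pCons 0 (P (Suc n)))"
    by (simp add: pCons_Q)
  also have "pCons 0 (P (Suc n)) * \<dots> = pCons 0 (P (Suc n)) * pCons 0 (P (Suc (Suc n)))
      + smult (g (Suc n)) (pCons 0 (P (Suc n)) * pCons 0 (P (Suc n)))"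
    by (simp add: distrib_left)
  finally have "wint t (l + 3) (P (Suc n) * Q (Suc n))
     = J (pCons 0 (P (Suc n)) * pCons 0 (P (Suc (Suc n)))) + g (Suc n) * J (pCons 0 (P (Suc n)) * pCons 0 (P (Suc n)))"
    by (simp only: wint_cube J_add wint_smult)
  also have "\<dots> = h (Suc n) * freud_form (g n) (e (Suc n)) (g (Suc n)) (e (Suc (Suc n))) (g (Suc (Suc n)))"
    by (simp only: J_xP_xP J_xP_xP_Suc)
       (simp add: h_Suc[of "Suc n"] \<beta>_eq \<alpha>_eq freud_form_def power2_eq_square algebra_simps)
  finally show ?thesis .
qed

text \<open>
  In both string equations the terms without t on the right are evaluated by degree: after integration by
  parts, each product contains an orthogonal polynomial against a polynomial of at most its own
  degree, so only leading coefficients survive. The terms with exponent l - 1 stay as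
  remainders.
\<close>
lemma string_even:
  "3 * wint t (l + 3) (P (Suc n) * Q n)
     = real (Suc n) * (g n * h n) + t * wint t (l - 1) (P (Suc n) * Q n)"
proof -
  have "J (P (Suc n) * Q n) = 0" by (simp add: J_P degree_Q coeff_eq_0)
  moreover have "wint t (l + 1) (P (Suc n) * pderiv (Q n)) = J (P (Suc n) * pCons 0 (pderiv (Q n)))"
    by (simp add: wint_shift)
  moreover have "J (P (Suc n) * pCons 0 (pderiv (Q n))) = 0"
    by (subst J_P) (auto simp: degree_pCons_eq_if degree_pderiv degree_Q coeff_pderiv coeff_eq_0)
  moreover have "wint t (l + 1) (Q n * pderiv (P (Suc n))) = real (Suc n) * (g n * h n)"
    by (subst wint_Q) (auto simp: degree_pderiv degree_P coeff_pderiv coeff_P)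
  ultimately show ?thesis
    unfolding wint_parts[OF t adm(1)] pderiv_mult wint_add[OF t adm(2)] by simp
qed

lemma string_odd:
  "3 * wint t (l + 3) (P n * Q n) = (real n + l + 1) * h n + t * wint t (l - 1) (P n * Q n)"
proof -
  have "J (P n * Q n) = h n" by (simp add: J_P degree_Q coeff_Q)
  moreover have "wint t (l + 1) (P n * pderiv (Q n)) = J (P n * pCons 0 (pderiv (Q n)))"
    by (simp add: wint_shift)
  moreover have "J (P n * pCons 0 (pderiv (Q n))) = real n * h n"
  proof (cases n)
    case (Suc m)
    then show ?thesis
      by (subst J_P) (auto simp: degree_pCons_eq_if degree_pderiv degree_Q coeff_pderiv coeff_Q)
  next
    case 0
    have "pderiv (Q 0) = 0" by (simp add: pderiv_eq_0_iff degree_Q)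
    then show ?thesis using 0 by simp
  qed
  moreover have "wint t (l + 1) (Q n * pderiv (P n)) = 0"
    by (subst wint_Q) (auto simp: degree_pderiv degree_P coeff_pderiv coeff_eq_0)
  ultimately show ?thesis
    unfolding wint_parts[OF t adm(1)] pderiv_mult wint_add[OF t adm(2)] by (simp add: algebra_simps)
qed


section \<open>A priori bounds\<close>

lemma cubic_moment_P: "3 * wint t (l + 3) (P n * P n) = (2 * real n + l + 1) * h n + t * wint t (l - 1) (P n * P n)"
proof -
  have "wint t (l + 1) (P n * pderiv (P n)) = real n * h n"
  proof -
    have "wint t (l + 1) (P n * pderiv (P n)) = J (P n * pCons 0 (pderiv (P n)))"
      by (simp add: wint_shift)
    also have "\<dots> = real n * h n"
    proof (cases n)
      case 0
      have "pderiv (P 0) = 0" by (simp add: pderiv_eq_0_iff degree_P)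
      then show ?thesis using 0 by simp
    next
      case (Suc m)
      then show ?thesis
        by (subst J_P) (auto simp: degree_pCons_eq_if degree_pderiv degree_P coeff_pderiv coeff_P)
    qed
    finally show ?thesis .
  qed
  then show ?thesis
    unfolding wint_parts[OF t adm(1)] pderiv_mult wint_add[OF t adm(2)]
    by (simp add: J_PP algebra_simps)
qed

text \<open>
  Integrating (P_n^2 w)' bounds \<langle>x^{-2}\<rangle> in terms of \<langle>x^2\<rangle>, up to
  a multiple of \<langle>x^{-1}\<rangle> whose sign depends on \<lambda>. The inequality
  2d x^{-1} \<le> x^{-2} + d^2 absorbs this multiple at the cost of a constant.
\<close>
lemma inverse_moment_P:
  obtains C where "C \<ge> 0"
    "\<And>n. t * wint t (l - 1) (P n * P n) \<le> 3 * wint t (l + 2) (P n * P n) + C * h n"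
proof (cases "t = 0")
  case True
  show ?thesis by (rule that[of 0]) (simp_all add: True wint_square_nonneg)
next
  case False
  with t have t0: "t > 0" by simp
  \<comment> \<open>The identity \<open>parts\<close> falls short of the claim by \<open>t - l\<close> times the first inverse moment, which forces \<open>2 * d * t = t - l\<close>.\<close>
  define d where "d = (t - l) / (2 * t)"
  show ?thesis
  proof (rule that)
    show "t * d\<^sup>2 \<ge> 0" using t0 by simp
    fix n
    have adm': "l - 1 > -1 \<or> t > 0" "l - 2 > -1 \<or> t > 0" using t0 by auto
    have "J (pderiv (P n * P n)) = 0"
      unfolding pderiv_mult J_add by (simp add: J_P degree_pderiv degree_P coeff_pderiv coeff_eq_0)
    then have parts: "3 * wint t (l + 2) (P n * P n)
        = l * wint t (l - 1) (P n * P n) + t * wint t (l - 2) (P n * P n)"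
      using wint_parts[OF t adm'(1), of "P n * P n"] by (simp add: algebra_simps)
    have "2 * d * wint t (l - 1) (P n * P n) \<le> wint t (l - 2) (P n * P n) + d\<^sup>2 * h n"
      using wint_linear_weight[OF t adm'(2), of 1 d "P n"] by (simp add: J_PP)
    moreover have "2 * d * t = t - l" using t0 by (simp add: d_def)
    then have "t * (2 * d * wint t (l - 1) (P n * P n)) = (t - l) * wint t (l - 1) (P n * P n)"
      by (simp add: mult_ac)
    ultimately have "(t - l) * wint t (l - 1) (P n * P n) \<le> t * wint t (l - 2) (P n * P n) + t * d\<^sup>2 * h n"
      using mult_left_mono[OF _ t] by (metis distrib_left mult.assoc)
    with parts show "t * wint t (l - 1) (P n * P n) \<le> 3 * wint t (l + 2) (P n * P n) + t * d\<^sup>2 * h n"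
      by (simp add: left_diff_distrib)
  qed
qed

text \<open>
  Here x^3 - 3x^2 + 4 = (x+1)(x-2)^2. The third moment enters with coefficient
  1, less than the coefficient 3 in \<open>cubic_moment_P\<close>, so the inverse moment there can be
  absorbed into the left-hand side.
\<close>
lemma square_moment_le_cube_moment:
  "3 * wint t (l + 2) (P n * P n) \<le> wint t (l + 3) (P n * P n) + 4 * h n"
  using wint_linear_weight[OF t adm(1), of 2 1 "P n"] wint_linear_weight[OF t adm(2), of 2 1 "P n"]
  by (simp add: J_PP add.assoc)

lemma \<alpha>_nonneg: "\<alpha> n \<ge> 0"
  using g_pos[of n] e_nonneg[of n] \<alpha>_eq[of n] by simp

text \<open>
  Jensen's inequality \<langle>x\<rangle>^3 \<le> \<langle>x^3\<rangle>, obtained from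
  (x + 2\<alpha>)(x-\<alpha>)^2 \<ge> 0 with \<alpha> = \<langle>x\<rangle>.
\<close>
lemma \<alpha>_cube_le: "(\<alpha> n) ^ 3 * h n \<le> wint t (l + 3) (P n * P n)"
proof -
  have J1: "wint t (l + 1) (P n * P n) = \<alpha> n * h n"
    using J_xP_P[of n] by (simp add: wint_shift)
  have a: "2 * \<alpha> n * (\<alpha> n * h n) \<le> (\<alpha> n)\<^sup>2 * h n + wint t (l + 2) (P n * P n)"
    using wint_linear_weight[OF t adm(1), of "\<alpha> n" 1 "P n"] by (simp add: J_PP J1)
  have b: "2 * \<alpha> n * wint t (l + 2) (P n * P n) \<le> (\<alpha> n)\<^sup>2 * (\<alpha> n * h n) + wint t (l + 3) (P n * P n)"
    using wint_linear_weight[OF t adm(2), of "\<alpha> n" 1 "P n"] by (simp add: J1 add.assoc)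
  have "2 * \<alpha> n * (2 * \<alpha> n * (\<alpha> n * h n)) \<le> 2 * \<alpha> n * ((\<alpha> n)\<^sup>2 * h n + wint t (l + 2) (P n * P n))"
    using \<alpha>_nonneg[of n] by (intro mult_left_mono[OF a]) simp
  with b show ?thesis by (simp add: power2_eq_square power3_eq_cube algebra_simps)
qed

lemma \<alpha>_bound:
  obtains C where "C \<ge> 0" "\<And>n. \<alpha> n \<le> root 3 (real n + C)"
proof -
  obtain C where C: "C \<ge> 0"
      "\<And>n. t * wint t (l - 1) (P n * P n) \<le> 3 * wint t (l + 2) (P n * P n) + C * h n"
    using inverse_moment_P by metis
  show ?thesis
  proof (rule that)
    show "(5 + l + C) / 2 \<ge> 0" using l C by simp
    fix n
    have "2 * wint t (l + 3) (P n * P n) \<le> (2 * real n + (5 + l + C)) * h n"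
      using cubic_moment_P[of n] C(2)[of n] square_moment_le_cube_moment[of n]
      by (simp add: algebra_simps)
    also have "\<dots> = 2 * ((real n + (5 + l + C) / 2) * h n)" by (simp add: field_simps)
    finally have "(\<alpha> n) ^ 3 * h n \<le> (real n + (5 + l + C) / 2) * h n"
      using \<alpha>_cube_le[of n] by linarith
    then have "(\<alpha> n) ^ 3 \<le> real n + (5 + l + C) / 2" using h_pos[of n] by simp
    then have "root 3 ((\<alpha> n) ^ 3) \<le> root 3 (real n + (5 + l + C) / 2)" by simp
    then show "\<alpha> n \<le> root 3 (real n + (5 + l + C) / 2)"
      by (simp add: odd_real_root_power_cancel)
  qed
qed

text \<open>
  For Q_n integration by parts at the exponent \<open>l\<close> itself is enough, because x w is
  the weight of Q_n; the remaining term has the favourable sign \<lambda> + 1 > 0.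
\<close>
lemma inverse_moment_Q:
  "t * wint t (l - 1) (Q n * Q n)
     \<le> 3 * (e (Suc n) * (\<alpha> (Suc n) + 2 * g n) + g n * \<alpha> n) * (g n * h n)"
proof -
  have "wint t (l + 1) (pderiv (Q n * Q n)) = 0"
    unfolding pderiv_mult wint_add[OF t adm(2)]
    by (simp add: wint_Q degree_pderiv degree_Q coeff_pderiv coeff_eq_0)
  then have "t * wint t (l - 1) (Q n * Q n) \<le> 3 * wint t (l + 3) (Q n * Q n)"
    using wint_parts[OF t adm(1), of "Q n * Q n"] wint_square_nonneg[of t l "Q n"] l
    by (simp add: mult_nonneg_nonneg)
  also have "wint t (l + 3) (Q n * Q n) = J (pCons 0 (pCons 0 (Q n)) * pCons 0 (Q n))"
    by (simp add: wint_cube)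
  also have "pCons 0 (pCons 0 (Q n)) * pCons 0 (Q n)
     = pCons 0 (P (Suc n)) * P (Suc n) + (smult (g n) (pCons 0 (P (Suc n)) * P n) + smult (g n) (pCons 0 (P (Suc n)) * P n))
        + smult (g n * g n) (pCons 0 (P n) * P n)"
    by (simp add: pCons_Q algebra_simps)
  also have "J \<dots> = \<alpha> (Suc n) * h (Suc n) + (g n * (\<beta> (Suc n) * h n) + g n * (\<beta> (Suc n) * h n)) + g n * g n * (\<alpha> n * h n)"
    by (simp only: J_add wint_smult J_xP_P J_xP_P_Suc)
  also have "\<dots> = (e (Suc n) * (\<alpha> (Suc n) + 2 * g n) + g n * \<alpha> n) * (g n * h n)"
    by (simp add: h_Suc \<beta>_eq algebra_simps)
  finally show ?thesis by (simp only: mult.assoc)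
qed

text \<open>
  With M = (k + 2 + C)^{1/3}, an upper bound for all coefficients involved, the two inverse
  moments in the Cauchy-Schwarz inequality are O(M^2) times the norms of P and Q, and the
  ratio of the norms contributes one more factor of size at most M. The squared remainders in
  the string equations are thus O(M^5) = O(k^{5/3}), and the remainders are O(k^{5/6}).
\<close>
lemma singular_term_bound:
  obtains C where "C \<ge> 0"
    "\<And>k n. n \<le> k \<Longrightarrow> (t * wint t (l - 1) (P (Suc n) * Q n) / (g n * h n))\<^sup>2
        \<le> 12 * (real k + 2 + C) * (9 * (root 3 (real k + 2 + C))\<^sup>2 + C)"
    "\<And>k n. n \<le> k \<Longrightarrow> (t * wint t (l - 1) (P (Suc n) * Q (Suc n)) / h (Suc n))\<^sup>2
        \<le> 12 * (real k + 2 + C) * (9 * (root 3 (real k + 2 + C))\<^sup>2 + C)"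
proof -
  obtain C1 where C1: "C1 \<ge> 0" "\<And>n. \<alpha> n \<le> root 3 (real n + C1)"
    using \<alpha>_bound by metis
  obtain C2 where C2: "C2 \<ge> 0"
      "\<And>n. t * wint t (l - 1) (P n * P n) \<le> 3 * wint t (l + 2) (P n * P n) + C2 * h n"
    using inverse_moment_P by metis
  define C where "C = C1 + C2"
  have C: "C \<ge> 0" "C \<ge> C1" "C \<ge> C2" using C1 C2 by (auto simp: C_def)
  have \<alpha>C: "\<alpha> n \<le> root 3 (real n + C)" for n
    by (rule order_trans[OF C1(2)]) (use C in simp)
  have key: "(t * wint t (l - 1) (P (Suc n) * Q n) / (g n * h n))\<^sup>2
        \<le> 12 * (real k + 2 + C) * (9 * (root 3 (real k + 2 + C))\<^sup>2 + C)" (is ?even)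
    "(t * wint t (l - 1) (P (Suc n) * Q (Suc n)) / h (Suc n))\<^sup>2
        \<le> 12 * (real k + 2 + C) * (9 * (root 3 (real k + 2 + C))\<^sup>2 + C)" (is ?odd)
    if nk: "n \<le> k" for n k
  proof -
    define M where "M = root 3 (real k + 2 + C)"
    have M0: "M > 0" unfolding M_def using C by simp
    have M3: "M ^ 3 = real k + 2 + C" unfolding M_def using C by (intro real_root_pow_pos2) auto
    have aM: "\<alpha> m \<le> M" if "m \<le> n + 2" for m
      unfolding M_def by (rule order_trans[OF \<alpha>C]) (use that nk in simp)
    have gM: "g m \<le> M" "0 < g m" "e m \<le> M" "0 \<le> e m" if "m \<le> n + 2" for m
      using aM[OF that] \<alpha>_eq[of m] g_pos[of m] e_nonneg[of m] by auto
    have "\<beta> (Suc (Suc n)) \<le> M * M" "\<beta> (Suc n) \<le> M * M" "(\<alpha> (Suc n))\<^sup>2 \<le> M * M"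
      unfolding \<beta>_eq power2_eq_square using gM aM M0 \<alpha>_nonneg[of "Suc n"] by (auto intro!: mult_mono)
    then have "\<beta> (Suc (Suc n)) + (\<alpha> (Suc n))\<^sup>2 + \<beta> (Suc n) \<le> 3 * M\<^sup>2" by (simp add: power2_eq_square)
    then have "h (Suc n) * (\<beta> (Suc (Suc n)) + (\<alpha> (Suc n))\<^sup>2 + \<beta> (Suc n)) \<le> h (Suc n) * (3 * M\<^sup>2)"
      using h_pos[of "Suc n"] by (intro mult_left_mono) auto
    moreover have "wint t (l + 2) (P (Suc n) * P (Suc n)) = J (pCons 0 (P (Suc n)) * pCons 0 (P (Suc n)))"
      by (simp add: wint_shift add.assoc)
    ultimately have "wint t (l + 2) (P (Suc n) * P (Suc n)) \<le> h (Suc n) * (3 * M\<^sup>2)"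
      by (simp only: J_xP_xP)
    moreover have "C2 * h (Suc n) \<le> C * h (Suc n)" using C h_pos[of "Suc n"] by (intro mult_right_mono) auto
    ultimately have PP: "t * wint t (l - 1) (P (Suc n) * P (Suc n)) \<le> (9 * M\<^sup>2 + C) * h (Suc n)"
      using C2(2)[of "Suc n"] by (simp add: algebra_simps)
    have QQ: "t * wint t (l - 1) (Q m * Q m) \<le> 12 * M\<^sup>2 * (g m * h m)" if m: "m \<le> n + 1" for m
    proof -
      have "e (Suc m) * (\<alpha> (Suc m) + 2 * g m) \<le> M * (M + 2 * M)" "g m * \<alpha> m \<le> M * M"
        using gM[of m] gM[of "Suc m"] aM[of m] aM[of "Suc m"] M0 m \<alpha>_nonneg[of m] \<alpha>_nonneg[of "Suc m"]
        by (auto intro!: mult_mono)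
      then have "3 * (e (Suc m) * (\<alpha> (Suc m) + 2 * g m) + g m * \<alpha> m) \<le> 12 * M\<^sup>2"
        by (simp add: power2_eq_square)
      then have "3 * (e (Suc m) * (\<alpha> (Suc m) + 2 * g m) + g m * \<alpha> m) * (g m * h m) \<le> 12 * M\<^sup>2 * (g m * h m)"
        using g_pos[of m] h_pos[of m] by (intro mult_right_mono) auto
      with inverse_moment_Q[of m] show ?thesis by linarith
    qed
    have CS: "(t * wint t (l - 1) (P (Suc n) * Q m))\<^sup>2
        \<le> ((9 * M\<^sup>2 + C) * h (Suc n)) * (12 * M\<^sup>2 * (g m * h m))" if m: "m \<le> n + 1" for m
    proof -
      have "(t * wint t (l - 1) (P (Suc n) * Q m))\<^sup>2
          \<le> (t * wint t (l - 1) (P (Suc n) * P (Suc n))) * (t * wint t (l - 1) (Q m * Q m))"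
      proof (cases "t = 0")
        case False
        then have "l - 1 > -1 \<or> t > 0" using t by simp
        from mult_left_mono[OF wint_cauchy_schwarz[OF t this, of "P (Suc n)" "Q m"], of "t\<^sup>2"]
        show ?thesis by (simp add: power_mult_distrib power2_eq_square mult_ac)
      qed simp
      also have "\<dots> \<le> ((9 * M\<^sup>2 + C) * h (Suc n)) * (12 * M\<^sup>2 * (g m * h m))"
        using C h_pos[of "Suc n"] t
        by (intro mult_mono PP QQ m mult_nonneg_nonneg wint_square_nonneg) auto
      finally show ?thesis .
    qed
    have le_M3: "(9 * M\<^sup>2 + C) * (12 * M\<^sup>2 * x) \<le> 12 * (real k + 2 + C) * (9 * M\<^sup>2 + C)"
      if "x \<le> M" for x
    proof -
      have "(9 * M\<^sup>2 + C) * (12 * M\<^sup>2 * x) \<le> (9 * M\<^sup>2 + C) * (12 * M\<^sup>2 * M)"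
        using that C by (intro mult_left_mono) auto
      also have "\<dots> = 12 * M ^ 3 * (9 * M\<^sup>2 + C)" by (simp add: power2_eq_square power3_eq_cube)
      finally show ?thesis unfolding M3 .
    qed
    have gh: "g n * h n > 0" using g_pos h_pos by simp
    have "(t * wint t (l - 1) (P (Suc n) * Q n) / (g n * h n))\<^sup>2
        \<le> ((9 * M\<^sup>2 + C) * h (Suc n)) * (12 * M\<^sup>2 * (g n * h n)) / (g n * h n)\<^sup>2"
      unfolding power_divide by (intro divide_right_mono CS) auto
    also have "\<dots> = (9 * M\<^sup>2 + C) * (12 * M\<^sup>2 * e (Suc n))"
    proof -
      have "((9 * M\<^sup>2 + C) * h (Suc n)) * (12 * M\<^sup>2 * (g n * h n))
          = (9 * M\<^sup>2 + C) * (12 * M\<^sup>2 * e (Suc n)) * (g n * h n)\<^sup>2"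
        unfolding h_Suc \<beta>_eq by (simp only: power2_eq_square mult_ac)
      moreover have "(g n * h n)\<^sup>2 \<noteq> 0" using g_pos[of n] h_pos[of n] by simp
      ultimately show ?thesis by (metis nonzero_mult_div_cancel_right)
    qed
    also note le_M3[OF gM(3)]
    finally show ?even unfolding M_def by simp
    have "(t * wint t (l - 1) (P (Suc n) * Q (Suc n)) / h (Suc n))\<^sup>2
        \<le> ((9 * M\<^sup>2 + C) * h (Suc n)) * (12 * M\<^sup>2 * (g (Suc n) * h (Suc n))) / (h (Suc n))\<^sup>2"
      unfolding power_divide by (intro divide_right_mono CS) auto
    also have "\<dots> = (9 * M\<^sup>2 + C) * (12 * M\<^sup>2 * g (Suc n))"
      using h_pos[of "Suc n"] by (simp add: power2_eq_square field_simps)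
    also note le_M3[OF gM(1)]
    finally show ?odd unfolding M_def by simp
  qed
  show ?thesis by (rule that[OF C(1) key])
qed

section \<open>Asymptotics of the recurrence coefficients\<close>

definition \<gamma> :: "nat \<Rightarrow> real" where
  "\<gamma> m = (if even m then e (m div 2) else g (m div 2))"

text \<open>
  With m the index of the first argument of the form, the string equations have the main terms
  n + 1 for m = 2n and n + 2 + \<lambda> for m = 2n + 1, in both cases m/2 + O(1).
\<close>
lemma \<gamma>_string_limit:
  "(\<lambda>m. freud_form (\<gamma> m) (\<gamma> (m+1)) (\<gamma> (m+2)) (\<gamma> (m+3)) (\<gamma> (m+4)) / real m) \<longlonglongrightarrow> 1 / 6"
proof -
  obtain C where C: "C \<ge> 0"
    "\<And>k n. n \<le> k \<Longrightarrow> (t * wint t (l - 1) (P (Suc n) * Q n) / (g n * h n))\<^sup>2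
        \<le> 12 * (real k + 2 + C) * (9 * (root 3 (real k + 2 + C))\<^sup>2 + C)"
    "\<And>k n. n \<le> k \<Longrightarrow> (t * wint t (l - 1) (P (Suc n) * Q (Suc n)) / h (Suc n))\<^sup>2
        \<le> 12 * (real k + 2 + C) * (9 * (root 3 (real k + 2 + C))\<^sup>2 + C)"
    using singular_term_bound by metis
  define S where "S = (\<lambda>m. freud_form (\<gamma> m) (\<gamma> (m+1)) (\<gamma> (m+2)) (\<gamma> (m+3)) (\<gamma> (m+4)))"
  define E where "E = (\<lambda>k :: nat. sqrt (12 * (real k + 2 + C) * (9 * (root 3 (real k + 2 + C))\<^sup>2 + C)))"
  have bound: "\<bar>3 * S k - real k / 2\<bar> \<le> (3 + \<bar>l\<bar>) + E k" for k
  proof (cases "even k")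
    case True
    then obtain n where n: "k = 2 * n" by (elim evenE)
    then have nk: "n \<le> k" by simp
    have S: "S k = freud_form (e n) (g n) (e (Suc n)) (g (Suc n)) (e (Suc (Suc n)))"
      unfolding S_def \<gamma>_def n by simp
    have gh: "g n * h n > 0" using g_pos h_pos by simp
    have "3 * S k * (g n * h n) = real (Suc n) * (g n * h n) + t * wint t (l - 1) (P (Suc n) * Q n)"
      using string_even[of n] unfolding freud_form_even S by (simp add: mult_ac)
    then have "3 * S k = (real (Suc n) * (g n * h n) + t * wint t (l - 1) (P (Suc n) * Q n)) / (g n * h n)"
      using gh by (metis less_irrefl nonzero_mult_div_cancel_right)
    also have "\<dots> = real (Suc n) + t * wint t (l - 1) (P (Suc n) * Q n) / (g n * h n)"
      using gh by (metis add_divide_distrib less_irrefl nonzero_mult_div_cancel_right)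
    finally have "3 * S k - real k / 2 = 1 + t * wint t (l - 1) (P (Suc n) * Q n) / (g n * h n)"
      using n by simp
    moreover have "\<bar>t * wint t (l - 1) (P (Suc n) * Q n) / (g n * h n)\<bar> \<le> E k"
      unfolding E_def using C(2)[OF nk] by (intro real_le_rsqrt) (simp only: power2_abs)
    ultimately show ?thesis by linarith
  next
    case False
    then obtain n where n: "k = 2 * n + 1" by (elim oddE)
    then have nk: "n \<le> k" by simp
    have S: "S k = freud_form (g n) (e (Suc n)) (g (Suc n)) (e (Suc (Suc n))) (g (Suc (Suc n)))"
      unfolding S_def \<gamma>_def n by simp
    have *: "3 * S k * h (Suc n) = (real (Suc n) + l + 1) * h (Suc n) + t * wint t (l - 1) (P (Suc n) * Q (Suc n))"
      using string_odd[of "Suc n"] unfolding freud_form_odd S by (simp add: mult_ac)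
    define x where "x = t * wint t (l - 1) (P (Suc n) * Q (Suc n)) / h (Suc n)"
    from * have "3 * S k - real k / 2 = 3 / 2 + l + x"
      using h_pos[of "Suc n"] n by (simp add: x_def field_simps)
    moreover have "\<bar>x\<bar> \<le> E k"
      unfolding E_def x_def using C(3)[OF nk] by (intro real_le_rsqrt) (simp only: power2_abs)
    ultimately show ?thesis by linarith
  qed
  have "(\<lambda>k. ((3 + \<bar>l\<bar>) + E k) / real k) \<longlonglongrightarrow> 0"
    unfolding E_def using C(1) by real_asymp
  moreover have "\<bar>3 * (S k / real k) - 1 / 2\<bar> \<le> ((3 + \<bar>l\<bar>) + E k) / real k" if "k > 0" for k
  proof -
    have "3 * (S k / real k) - 1 / 2 = (3 * S k - real k / 2) / real k" using that by (simp add: field_simps)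
    then show ?thesis using bound[of k] that by (simp add: divide_right_mono)
  qed
  ultimately have "(\<lambda>k. 3 * (S k / real k) - 1 / 2) \<longlonglongrightarrow> 0"
    by (intro Lim_null_comparison[where f = "\<lambda>k. 3 * (S k / real k) - 1 / 2"])
       (auto intro!: eventually_mono[OF eventually_gt_at_top[of 0]])
  then have "(\<lambda>k. (3 * (S k / real k) - 1 / 2 + 1 / 2) / 3) \<longlonglongrightarrow> (0 + 1 / 2) / 3"
    by (intro tendsto_intros) auto
  then show ?thesis unfolding S_def by simp
qed

lemma \<gamma>_limit: "(\<lambda>m. \<gamma> m / root 3 m) \<longlonglongrightarrow> root 3 (1 / 60)"
proof -
  obtain C where C: "C \<ge> 0" "\<And>n. \<alpha> n \<le> root 3 (real n + C)"
    using \<alpha>_bound by metis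
  have nonneg: "0 \<le> \<gamma> m" for m
    using g_pos[of "m div 2"] e_nonneg[of "m div 2"] by (simp add: \<gamma>_def)
  have "\<gamma> m / root 3 m \<le> root 3 (1 + C)" for m
  proof (cases "m = 0")
    case False
    have "\<gamma> m \<le> \<alpha> (m div 2)"
      using g_pos[of "m div 2"] e_nonneg[of "m div 2"] by (simp add: \<gamma>_def \<alpha>_eq)
    also have "\<dots> \<le> root 3 (real (m div 2) + C)" by (rule C(2))
    also have "\<dots> \<le> root 3 ((1 + C) * real m)"
    proof -
      have "real (m div 2) \<le> real m" by simp
      moreover have "C * 1 \<le> C * real m" using C(1) False by (intro mult_left_mono) auto
      ultimately have "real (m div 2) + C \<le> (1 + C) * real m" by (simp add: distrib_right)
      then show ?thesis by simp
    qed
    finally show ?thesis using False by (simp add: real_root_mult divide_le_eq)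
  qed (use C in simp)
  from freud_form_limit[OF nonneg this \<gamma>_string_limit] show ?thesis by simp
qed

end

text \<open>
  With \<gamma>_m \<sim> (m/60)^{1/3}, both \<gamma>_{2n} and \<gamma>_{2n+1} are asymptotic to
  d n^{1/3} for d = (1/30)^{1/3}, so that \<alpha>_n \<sim> 2d n^{1/3} and
  \<beta>_n \<sim> d^2 n^{2/3}.
\<close>
theorem theorem4p1:
  fixes l t :: real
    and P :: "nat \<Rightarrow> real poly"
    and h \<alpha> \<beta> :: "nat \<Rightarrow> real"
  assumes "l > -1" and "t \<ge> 0"
    and "monic_orthogonal_polys (cubic_weight l t) P h"
    and "recurrence_coeffs P \<alpha> \<beta>"
  shows "(\<lambda>n. \<alpha> n / root 3 (4 * real n / 15)) \<longlonglongrightarrow> 1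
       \<and> (\<lambda>n. \<beta> n / root 3 ((real n)\<^sup>2 / 900)) \<longlonglongrightarrow> 1"
proof -
  interpret cubic_orthogonal l t P h \<alpha> \<beta>
    by (rule cubic_orthogonal.intro) (rule assms)+
  define d where "d = root 3 (1 / 30)"
  have d: "d \<noteq> 0" and d2: "d\<^sup>2 = root 3 (1 / 900)" and two_d: "2 * d = root 3 (4 / 15)"
  proof -
    show "d \<noteq> 0" by (simp add: d_def)
    show "d\<^sup>2 = root 3 (1 / 900)" by (simp add: d_def power2_eq_square flip: real_root_mult)
    have "root 3 8 = 2" using real_root_power_cancel[of 3 2] by simp
    then show "2 * d = root 3 (4 / 15)" using real_root_mult[of 3 8 "1 / 30"] by (simp add: d_def)
  qed
  have c: "root 3 (1 / 60) * root 3 2 = d" unfolding d_def by (simp flip: real_root_mult)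

  have "(\<lambda>n. \<gamma> (2 * n) / root 3 (real (2 * n))) \<longlonglongrightarrow> root 3 (1 / 60)"
    using LIMSEQ_subseq_LIMSEQ[OF \<gamma>_limit, of "\<lambda>n. 2 * n"] by (simp add: strict_mono_def o_def)
  then have "(\<lambda>n. \<gamma> (2 * n) / root 3 (real (2 * n)) * root 3 2) \<longlonglongrightarrow> root 3 (1 / 60) * root 3 2"
    by (intro tendsto_mult tendsto_const)
  then have e_lim: "(\<lambda>n. e n / root 3 (real n)) \<longlonglongrightarrow> d"
    unfolding c by (simp add: \<gamma>_def real_root_mult)

  have g_lim: "(\<lambda>n. g n / root 3 (real (n + j))) \<longlonglongrightarrow> d" for j
  proof -
    have "(\<lambda>n. \<gamma> (2 * n + 1) / root 3 (real (2 * n + 1))) \<longlonglongrightarrow> root 3 (1 / 60)"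
      using LIMSEQ_subseq_LIMSEQ[OF \<gamma>_limit, of "\<lambda>n. 2 * n + 1"] by (simp add: strict_mono_def o_def)
    moreover have "(\<lambda>n. root 3 (real (2 * n + 1) / real (n + j))) \<longlonglongrightarrow> root 3 2"
      by (intro tendsto_real_root) real_asymp
    ultimately have "(\<lambda>n. \<gamma> (2 * n + 1) / root 3 (real (2 * n + 1)) * root 3 (real (2 * n + 1) / real (n + j)))
        \<longlonglongrightarrow> root 3 (1 / 60) * root 3 2"
      by (rule tendsto_mult)
    moreover have "\<gamma> (2 * n + 1) / root 3 (real (2 * n + 1)) * root 3 (real (2 * n + 1) / real (n + j))
        = g n / root 3 (real (n + j))" for n
      by (simp add: \<gamma>_def real_root_divide add_nonneg_eq_0_iff)
    ultimately show ?thesis unfolding c by simp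
  qed

  have "(\<lambda>n. (g n / root 3 (real n) + e n / root 3 (real n)) / root 3 (4 / 15)) \<longlonglongrightarrow> (d + d) / root 3 (4 / 15)"
    using g_lim[of 0] e_lim by (intro tendsto_intros) auto
  moreover have "(d + d) / root 3 (4 / 15) = 1" using two_d d by simp
  moreover have "(g n / root 3 (real n) + e n / root 3 (real n)) / root 3 (4 / 15) = \<alpha> n / root 3 (4 * real n / 15)" for n
    using real_root_mult[of 3 "real n" "4 / 15"] by (simp add: \<alpha>_eq add_divide_distrib mult.commute)
  ultimately have "(\<lambda>n. \<alpha> n / root 3 (4 * real n / 15)) \<longlonglongrightarrow> 1" by (simp only:)
  moreover have "(\<lambda>n. \<beta> n / root 3 ((real n)\<^sup>2 / 900)) \<longlonglongrightarrow> 1"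
  proof (rule LIMSEQ_imp_Suc)
    have "(\<lambda>n. (g n / root 3 (real (n + 1))) * (e (Suc n) / root 3 (real (Suc n))) / d\<^sup>2) \<longlonglongrightarrow> d * d / d\<^sup>2"
      using d by (intro tendsto_intros g_lim LIMSEQ_Suc[OF e_lim]) auto
    moreover have "d * d / d\<^sup>2 = 1" using d by (simp add: power2_eq_square)
    moreover have "(g n / root 3 (real (n + 1))) * (e (Suc n) / root 3 (real (Suc n))) / d\<^sup>2
        = \<beta> (Suc n) / root 3 ((real (Suc n))\<^sup>2 / 900)" for n
    proof -
      have "root 3 ((real (Suc n))\<^sup>2 / 900) = root 3 (real (Suc n)) * root 3 (real (Suc n)) * d\<^sup>2"
        unfolding d2 by (simp add: power2_eq_square flip: real_root_mult)
      then show ?thesis unfolding \<beta>_eq by simp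
    qed
    ultimately show "(\<lambda>n. \<beta> (Suc n) / root 3 ((real (Suc n))\<^sup>2 / 900)) \<longlonglongrightarrow> 1" by (simp only:)
  qed
  ultimately show ?thesis by blast
qed

end
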